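(* Let $(e_i)$ be a basic sequence in a Banach space which is invariant under spreading. Suppose that there exists $K>0$ such that for all $\alpha,\beta\in\operatorname{span}((e_i))$, $$\frac1K\|\alpha\|\,\|\beta\|\le\|\alpha\otimes\beta\|\le K\|\alpha\|\,\|\beta\|.$$ Then $(e_i)$ is equivalent to the unit vector basis of $c_0$ or of $\ell_p$ for some $1\le p<\infty$.
   Context: $\operatorname{span}((e_i))$ denotes the set of finite linear combinations of the $e_i$. The multiplication $\otimes$ on $\operatorname{span}((e_i))$: for $\alpha=\sum_{i=1}^n a_ie_i$ and $\beta=\sum_{j=1}^m b_je_j$ with $b_m\ne0$, $$\alpha\otimes\beta=\sum_{i=1}^n a_i\Big(\sum_{j=1}^m b_j e_{(i-1)m+j}\Big),$$ and $\alpha\otimes 0=0$. A basic sequence $(e_i)$ is invariant under spreading (IS) if there exists $C>0$ such that $$\frac1C\Big\|\sum_{i=1}^n a_ie_i\Big\|\le\Big\|\sum_{j=1}^n a_je_{i_j}\Big\|\le C\Big\|\sum_{i=1}^n a_ie_i\Big\|$$ for all $n\ge1$, all $i_1<\cdots<i_n$, and all scalars $(a_i)_{i=1}^n$. Two basic sequences $(x_i)$, $(y_i)$ are equivalent if there is $C>0$ with $\frac1C\|\sum a_ix_i\|\le\|\sum a_iy_i\|\le C\|\sum a_ix_i\|$ for all finitely supported scalar sequences $(a_i)$. *)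

theory Defs
  imports "HOL-Analysis.Analysis" "HOL-Library.Function_Algebras"
begin

(* A Banach space over the scalar field 'k.  Completeness is part of the sort banach of 'a.
   A field of sort real_normed_field (multiplicative norm, extending that of the reals) is
   isomorphic to the real or to the complex numbers, so the two classical cases are covered:
   'k = real with smul = scaleR, and 'k = complex. *)
locale banach_space_over = vector_space smul
  for smul :: "'k::real_normed_field \<Rightarrow> 'a::banach \<Rightarrow> 'a" +
  assumes norm_scale: "norm (smul c x) = norm c * norm x"
    and scale_of_real: "smul (of_real r) x = r *\<^sub>R x"

(* Sequences are indexed from 0: e i here is e_(i+1) of the usual notation. *)

(* Schauder basis of the closed linear span *)
definition basic_sequence ::
  "('k::real_normed_field \<Rightarrow> 'a::banach \<Rightarrow> 'a) \<Rightarrow> (nat \<Rightarrow> 'a) \<Rightarrow> bool" where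
  "basic_sequence smul e \<longleftrightarrow>
     (\<forall>x \<in> closure (module.span smul (range e)). \<exists>!a. (\<lambda>i. smul (a i) (e i)) sums x)"

definition invariant_under_spreading ::
  "('k::real_normed_field \<Rightarrow> 'a::banach \<Rightarrow> 'a) \<Rightarrow> (nat \<Rightarrow> 'a) \<Rightarrow> bool" where
  "invariant_under_spreading smul e \<longleftrightarrow>
     (\<exists>C>0. \<forall>n\<ge>1. \<forall>k :: nat \<Rightarrow> nat. \<forall>a :: nat \<Rightarrow> 'k. strict_mono_on {..<n} k \<longrightarrow>
        1 / C * norm (\<Sum>i<n. smul (a i) (e i)) \<le> norm (\<Sum>i<n. smul (a i) (e (k i))) \<and>
        norm (\<Sum>i<n. smul (a i) (e (k i))) \<le> C * norm (\<Sum>i<n. smul (a i) (e i)))"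

(* The i-th coefficient of x in span (e_i); meaningful when the e_i are linearly independent
   and pairwise distinct, in particular for basic sequences. *)
definition coord ::
  "('k::real_normed_field \<Rightarrow> 'a::banach \<Rightarrow> 'a) \<Rightarrow> (nat \<Rightarrow> 'a) \<Rightarrow> 'a \<Rightarrow> nat \<Rightarrow> 'k" where
  "coord smul e x i = module.representation smul (range e) x (e i)"

(* One more than the index of the last nonzero coefficient of x; 0 for x = 0. *)
definition coord_length ::
  "('k::real_normed_field \<Rightarrow> 'a::banach \<Rightarrow> 'a) \<Rightarrow> (nat \<Rightarrow> 'a) \<Rightarrow> 'a \<Rightarrow> nat" where
  "coord_length smul e x = (LEAST m. \<forall>i\<ge>m. coord smul e x i = 0)"

(* See tensor_sum and tensor_zero_right below. *)
definition tensor ::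
  "('k::real_normed_field \<Rightarrow> 'a::banach \<Rightarrow> 'a) \<Rightarrow> (nat \<Rightarrow> 'a) \<Rightarrow> 'a \<Rightarrow> 'a \<Rightarrow> 'a" where
  "tensor smul e \<alpha> \<beta> =
     (let n = coord_length smul e \<alpha>; m = coord_length smul e \<beta> in
      \<Sum>i<n. smul (coord smul e \<alpha> i) (\<Sum>j<m. smul (coord smul e \<beta> j) (e (i * m + j))))"

(* Equivalence of a sequence x in a space with norm N and scalar multiplication s with a
   sequence y in a space with norm N' and scalar multiplication s'.  Norms are passed
   explicitly because c_0 and l_p are not types. *)
definition equivalent_sequences ::
  "('a::comm_monoid_add \<Rightarrow> real) \<Rightarrow> ('k::real_normed_field \<Rightarrow> 'a \<Rightarrow> 'a) \<Rightarrow> (nat \<Rightarrow> 'a) \<Rightarrow>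
   ('b::comm_monoid_add \<Rightarrow> real) \<Rightarrow> ('k \<Rightarrow> 'b \<Rightarrow> 'b) \<Rightarrow> (nat \<Rightarrow> 'b) \<Rightarrow> bool" where
  "equivalent_sequences N s x N' s' y \<longleftrightarrow>
     (\<exists>C>0. \<forall>a :: nat \<Rightarrow> 'k. finite {i. a i \<noteq> 0} \<longrightarrow>
        1 / C * N (\<Sum>i | a i \<noteq> 0. s (a i) (x i)) \<le> N' (\<Sum>i | a i \<noteq> 0. s' (a i) (y i)) \<and>
        N' (\<Sum>i | a i \<noteq> 0. s' (a i) (y i)) \<le> C * N (\<Sum>i | a i \<noteq> 0. s (a i) (x i)))"

(* The scalar sequence spaces c_0 and l_p, for scalar sequences nat => 'k with pointwise
   addition (Function_Algebras) *)

definition seq_scale :: "'k::real_normed_field \<Rightarrow> (nat \<Rightarrow> 'k) \<Rightarrow> nat \<Rightarrow> 'k" where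
  "seq_scale c x = (\<lambda>i. c * x i)"

definition unit_vec :: "nat \<Rightarrow> nat \<Rightarrow> 'k::real_normed_field" where
  "unit_vec i = (\<lambda>j. if j = i then 1 else 0)"

definition c0_norm :: "(nat \<Rightarrow> 'k::real_normed_field) \<Rightarrow> real" where
  "c0_norm x = (SUP i. norm (x i))"

definition lp_norm :: "real \<Rightarrow> (nat \<Rightarrow> 'k::real_normed_field) \<Rightarrow> real" where
  "lp_norm p x = (\<Sum>i. norm (x i) powr p) powr (1 / p)"

definition equivalent_to_c0_basis ::
  "('k::real_normed_field \<Rightarrow> 'a::banach \<Rightarrow> 'a) \<Rightarrow> (nat \<Rightarrow> 'a) \<Rightarrow> bool" where
  "equivalent_to_c0_basis smul e \<longleftrightarrow>
     equivalent_sequences norm smul e c0_norm seq_scale unit_vec"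

definition equivalent_to_lp_basis ::
  "real \<Rightarrow> ('k::real_normed_field \<Rightarrow> 'a::banach \<Rightarrow> 'a) \<Rightarrow> (nat \<Rightarrow> 'a) \<Rightarrow> bool" where
  "equivalent_to_lp_basis p smul e \<longleftrightarrow>
     equivalent_sequences norm smul e (lp_norm p) seq_scale unit_vec"

(* The coefficients of a finite linear combination of a basic sequence are well defined. *)

lemma (in banach_space_over) coord_sum:
  assumes basic: "basic_sequence smul e" and fin: "finite S"
  shows "coord smul e (\<Sum>i\<in>S. smul (a i) (e i)) k = (if k \<in> S then a k else 0)"
proof -
  have uniq: "b = c" if "(\<lambda>i. smul (b i) (e i)) sums x" "(\<lambda>i. smul (c i) (e i)) sums x"
    "x \<in> local.span (range e)" for b c x
    using basic that closure_subset[of "local.span (range e)"]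
    unfolding basic_sequence_def by blast
  have sums: "(\<lambda>i. smul (if i \<in> T then b i else 0) (e i)) sums (\<Sum>i\<in>T. smul (b i) (e i))"
    if "finite T" for T b
    using sums_If_finite_set[OF that, of "\<lambda>i. smul (b i) (e i)"]
    by (simp add: if_distrib[of "\<lambda>c. smul c _"] cong: if_cong)
  have in_span: "(\<Sum>i\<in>T. smul (b i) (e i)) \<in> local.span (range e)" for T b
    by (intro local.span_sum local.span_scale local.span_base rangeI)
  have eqD: "(\<lambda>i. if i \<in> T then b i else 0) = (\<lambda>i. if i \<in> U then c i else 0)"
    if "finite T" "finite U" "(\<Sum>i\<in>T. smul (b i) (e i)) = (\<Sum>i\<in>U. smul (c i) (e i))" for T U b c
    using uniq[OF sums[OF that(1), of b] _ in_span] sums[OF that(2), of c] that(3) by metis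
  have inj: "inj e"
  proof (rule injI)
    fix i j assume "e i = e j"
    then have "(\<Sum>i\<in>{i}. smul 1 (e i)) = (\<Sum>i\<in>{j}. smul 1 (e i))" by simp
    then have "(if i \<in> {i} then (1::'k) else 0) = (if i \<in> {j} then 1 else 0)"
      using eqD[of "{i}" "{j}" "\<lambda>_. 1" "\<lambda>_. 1"] by (meson finite.intros fun_cong)
    then show "i = j" by (simp split: if_splits)
  qed
  have indep: "local.independent (range e)"
    unfolding local.independent_explicit_module
  proof (intro allI impI)
    fix t u v
    assume t: "finite t" "t \<subseteq> range e" "(\<Sum>v\<in>t. smul (u v) v) = 0" "v \<in> t"
    define T where "T = e -` t"
    have T: "finite T" "t = e ` T"
      using t inj by (auto simp: T_def finite_vimageI)
    have "(\<Sum>i\<in>T. smul (u (e i)) (e i)) = (\<Sum>i\<in>{}. smul 0 (e i))"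
      using t(3) inj by (simp add: T(2) sum.reindex inj_on_def)
    from eqD[OF T(1) finite.emptyI this]
    have "\<And>i. (if i \<in> T then u (e i) else 0) = 0" by (metis empty_iff)
    then show "u v = 0" using t(4) T(2) by (metis imageE)
  qed
  let ?f = "\<lambda>v. if v \<in> e ` S then a (inv e v) else 0"
  have f: "?f (e i) = (if i \<in> S then a i else 0)" for i
    using inj by (auto simp: inj_image_mem_iff)
  have "local.representation (range e) (\<Sum>i\<in>S. smul (a i) (e i)) = ?f"
  proof (rule local.representation_eqI[OF indep in_span])
    show "finite {b. ?f b \<noteq> 0}" using fin by (auto intro: finite_subset[of _ "e ` S"])
    show "(\<Sum>b | ?f b \<noteq> 0. smul (?f b) b) = (\<Sum>i\<in>S. smul (a i) (e i))"
    proof -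
      have "(\<Sum>b | ?f b \<noteq> 0. smul (?f b) b) = (\<Sum>b\<in>e ` S. smul (?f b) b)"
        using fin by (intro sum.mono_neutral_left) auto
      also have "\<dots> = (\<Sum>i\<in>S. smul (?f (e i)) (e i))"
        using inj by (subst sum.reindex) (auto simp: inj_on_def)
      finally show ?thesis using inj by simp
    qed
  qed (auto split: if_splits)
  then show ?thesis by (simp add: coord_def f)
qed

lemma (in banach_space_over) tensor_sum:
  assumes basic: "basic_sequence smul e" and m: "m \<ge> 1" "b (m - 1) \<noteq> 0"
  shows "tensor smul e (\<Sum>i<n. smul (a i) (e i)) (\<Sum>j<m. smul (b j) (e j)) =
    (\<Sum>i<n. smul (a i) (\<Sum>j<m. smul (b j) (e (i * m + j))))"
proof -
  note c = coord_sum[OF basic finite_lessThan]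
  have lb: "coord_length smul e (\<Sum>j<m. smul (b j) (e j)) = m"
    unfolding coord_length_def
  proof (rule Least_equality)
    fix k assume k: "\<forall>i\<ge>k. coord smul e (\<Sum>j<m. smul (b j) (e j)) i = 0"
    show "m \<le> k"
    proof (rule ccontr)
      assume "\<not> m \<le> k"
      then have "k \<le> m - 1" by simp
      with k have "coord smul e (\<Sum>j<m. smul (b j) (e j)) (m - 1) = 0" by blast
      with m show False by (simp add: c)
    qed
  qed (simp add: c)
  define x where "x = (\<Sum>i<n. smul (a i) (e i))"
  define l where "l = coord_length smul e x"
  have cx: "coord smul e x i = (if i < n then a i else 0)" for i
    by (simp add: x_def c)
  have "\<forall>i\<ge>n. coord smul e x i = 0" by (simp add: cx)
  then have ln: "l \<le> n" and l0: "\<forall>i\<ge>l. coord smul e x i = 0"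
    unfolding l_def coord_length_def by (rule Least_le, rule LeastI)
  have "(\<Sum>i<l. smul (coord smul e x i) (g i)) = (\<Sum>i<n. smul (a i) (g i))" for g
  proof -
    have "(\<Sum>i<l. smul (coord smul e x i) (g i)) = (\<Sum>i<n. smul (coord smul e x i) (g i))"
      using ln l0 by (intro sum.mono_neutral_left) auto
    then show ?thesis by (simp add: cx)
  qed
  then show ?thesis
    unfolding tensor_def Let_def lb x_def[symmetric] l_def[symmetric] by (simp add: c)
qed

lemma (in banach_space_over) tensor_zero_right:
  "tensor smul e \<alpha> 0 = 0"
proof -
  have "coord_length smul e 0 = 0"
    by (simp add: coord_length_def coord_def local.representation_zero)
  then show ?thesis by (simp add: tensor_def)
qed

end

theory Submission
  imports Defs "HOL-Real_Asymp.Real_Asymp"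
begin

text \<open>
  Spreading makes the differences \<open>e (2 * i) - e (2 * i + 1)\<close> suppression unconditional: an
  unwanted term is replaced by the average of its translates, which telescopes to something
  small. These differences arise by tensoring with \<open>(1, -1)\<close>, so multiplicativity transfers
  unconditionality to \<open>e\<close> itself. The norm of \<open>e 0 + \<dots> + e (n - 1)\<close> is then monotone and
  multiplicative in \<open>n\<close> up to constants, hence comparable to \<open>n powr s\<close> with \<open>0 \<le> s \<le> 1\<close>.
  Finally, the \<open>k\<close>-fold tensor power of a vector with \<open>n\<close> coefficients has at most
  \<open>(k + 1) ^ n\<close> distinct coefficients. Grouping equal coefficients therefore determines its norm
  up to a factor polynomial in \<open>k\<close>, and taking \<open>k\<close>-th roots compares the norm of the vector
  with its \<open>l_p\<close> norm for \<open>p = 1 / s\<close> (its \<open>c_0\<close> norm if \<open>s = 0\<close>), up to the constant \<open>K\<close>.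
\<close>

section \<open>Sums over consecutive blocks of equal length\<close>

lemma sum_lessThan_mult:
  fixes f :: "nat \<Rightarrow> 'b::comm_monoid_add"
  shows "(\<Sum>q<n * m. f q) = (\<Sum>i<n. \<Sum>j<m. f (i * m + j))"
proof -
  have "(\<Sum>j<m. f (i * m + j)) = sum f {i * m..<i * m + m}" for i
    using sum.shift_bounds_nat_ivl[of f 0 "i * m" m]
    by (simp add: atLeast0LessThan add.commute)
  then show ?thesis
    by (simp add: sum.nat_group)
qed

lemma sum_lessThan_2: "(\<Sum>j<(2::nat). f j) = f 0 + f 1"
  by (simp add: numeral_2_eq_2)

lemma sum_div_mod_mult:
  fixes g h :: "nat \<Rightarrow> 'b::semiring_0"
  shows "(\<Sum>q<n * m. g (q div m) * h (q mod m)) = (\<Sum>i<n. g i) * (\<Sum>j<m. h j)"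
  by (simp add: sum_lessThan_mult sum_product)

section \<open>Growth comparison and approximate power laws\<close>

text \<open>If \<open>y < x\<close>, division by \<open>x ^ k\<close> would bound a polynomial times
  a geometric null sequence below by 1. This is the form in which \<open>k\<close>-th roots are
  taken later.\<close>

lemma le_if_powers_le_polynomial:
  fixes x y D :: real
  assumes y: "y \<ge> 0" and le: "\<And>k. x ^ k \<le> D * real (k + 1) ^ n * y ^ k"
  shows "x \<le> y"
proof (rule ccontr)
  assume "\<not> x \<le> y"
  then have xy: "y < x" and x: "x > 0" using y by auto
  define r where "r = y / x"
  have r: "0 \<le> r" "r < 1" using xy x y by (auto simp: r_def)
  have ge: "1 \<le> D * real (k + 1) ^ n * r ^ k" for k
    using le[of k] x by (simp add: r_def power_divide field_simps)
  have "(\<lambda>k. D * real (k + 1) ^ n * r ^ k) \<longlonglongrightarrow> 0"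
  proof (cases "r = 0")
    case True
    have "eventually (\<lambda>k. D * real (k + 1) ^ n * r ^ k = 0) sequentially"
      using True by (auto intro!: eventually_sequentiallyI[of 1])
    then show ?thesis by (rule tendsto_eventually)
  next
    case False
    with r have "0 < r" by simp
    with r show ?thesis by real_asymp
  qed
  then have "1 \<le> (0::real)"
    by (rule LIMSEQ_le_const) (use ge in auto)
  then show False by simp
qed

lemma nonpos_if_multiples_bounded:
  fixes x B :: real
  assumes "\<And>k. real k * x \<le> B"
  shows "x \<le> 0"
  using assms reals_Archimedean3[of x] by (meson not_le)

text \<open>Comparing powers \<open>n ^ k \<le> m ^ j\<close> shows that \<open>L n / ln n\<close>
  is nearly independent of \<open>n \<ge> 2\<close>: the error of \<open>L\<close> on a
  \<open>k\<close>-th power grows only linearly in \<open>k\<close>, so it amounts to shifting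
  \<open>L\<close> by a multiple of \<open>\<kappa>\<close>.\<close>

lemma quasi_additive_logarithmic:
  fixes L :: "nat \<Rightarrow> real"
  assumes add: "\<And>m n. m \<ge> 1 \<Longrightarrow> n \<ge> 1 \<Longrightarrow> \<bar>L (m * n) - L m - L n\<bar> \<le> \<kappa>"
    and mono: "\<And>m n. m \<ge> 1 \<Longrightarrow> m \<le> n \<Longrightarrow> L m \<le> L n + \<kappa>"
    and upper: "\<And>n. n \<ge> 1 \<Longrightarrow> L n \<le> ln (real n) + \<kappa>"
  obtains s where "0 \<le> s" "s \<le> 1" "\<And>n. n \<ge> 1 \<Longrightarrow> \<bar>L n - s * ln (real n)\<bar> \<le> 2 * \<kappa>"
proof -
  have L1: "\<bar>L 1\<bar> \<le> \<kappa>" using add[of 1 1] by simp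
  then have \<kappa>: "\<kappa> \<ge> 0" by linarith
  have lower: "- (2 * \<kappa>) \<le> L n" if "n \<ge> 1" for n
    using mono[of 1 n] L1 that by linarith
  have pow: "\<bar>L (n ^ k) - real k * L n\<bar> \<le> (real k + 1) * \<kappa>" if "n \<ge> 1" for n k
  proof (induction k)
    case 0
    then show ?case using L1 by simp
  next
    case (Suc k)
    have "\<bar>L (n * n ^ k) - L n - L (n ^ k)\<bar> \<le> \<kappa>"
      using that by (intro add) auto
    with Suc show ?case by (simp add: algebra_simps abs_le_iff)
  qed
  have lnpos: "ln (real n) > 0" if "n \<ge> 2" for n using that by simp
  have cmp: "(L n - \<kappa>) / ln n \<le> (L m + 2 * \<kappa>) / ln m" if n: "n \<ge> 2" and m: "m \<ge> 2" for m n
  proof -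
    have "(L n - \<kappa>) - ln n / ln m * (L m + 2 * \<kappa>) \<le> 0"
    proof (rule nonpos_if_multiples_bounded)
      fix k
      \<comment> \<open>The least exponent with \<open>n ^ k \<le> m ^ j\<close>; rounding up costs
        at most 1, hence an error independent of \<open>k\<close>.\<close>
      define j where "j = nat \<lceil>real k * ln n / ln m\<rceil>"
      have q0: "0 \<le> real k * ln n / ln m" using lnpos[OF n] lnpos[OF m] by simp
      have j1: "real k * ln n / ln m \<le> real j"
        unfolding j_def by (rule real_nat_ceiling_ge)
      have j2: "real j \<le> real k * ln n / ln m + 1"
        using q0 unfolding j_def by linarith
      have "ln (real (n ^ k)) \<le> ln (real (m ^ j))"
        using j1 lnpos[OF m] n m by (simp add: ln_realpow field_simps)
      then have le: "n ^ k \<le> m ^ j"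
        using n m by (subst (asm) ln_le_cancel_iff) (auto simp del: of_nat_power)
      have "L (n ^ k) \<le> L (m ^ j) + \<kappa>"
        using n le by (intro mono) auto
      moreover have "real k * L n - (real k + 1) * \<kappa> \<le> L (n ^ k)"
        using pow[of n k] n by (simp add: abs_le_iff)
      moreover have "L (m ^ j) \<le> real j * L m + (real j + 1) * \<kappa>"
        using pow[of m j] m by (simp add: abs_le_iff)
      ultimately have "real k * (L n - \<kappa>) \<le> real j * (L m + \<kappa>) + 3 * \<kappa>"
        by (simp add: algebra_simps)
      \<comment> \<open>The larger shift makes the second factor nonnegative by
        \<open>lower\<close>, so that it may be multiplied with the bound \<open>j2\<close>.\<close>
      also have "real j * (L m + \<kappa>) \<le> real j * (L m + 2 * \<kappa>)"
        using \<kappa> by (intro mult_left_mono) auto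
      also have "\<dots> \<le> (real k * ln n / ln m + 1) * (L m + 2 * \<kappa>)"
        using j2 lower[of m] m by (intro mult_right_mono) auto
      finally show "real k * ((L n - \<kappa>) - ln n / ln m * (L m + 2 * \<kappa>)) \<le> L m + 5 * \<kappa>"
        by (simp add: algebra_simps add_divide_distrib)
    qed
    then show ?thesis using lnpos[OF n] lnpos[OF m] by (simp add: field_simps)
  qed
  \<comment> \<open>By \<open>cmp\<close>, all quotients shifted by \<open>- \<kappa>\<close> lie
    below all quotients shifted by \<open>2 * \<kappa>\<close>; the supremum of the former separates
    the two families and is a slope for all \<open>n\<close> at once.\<close>
  define s where "s = (SUP n\<in>{2..}. (L n - \<kappa>) / ln (real n))"
  have bdd: "bdd_above ((\<lambda>n. (L n - \<kappa>) / ln (real n)) ` {2..})"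
    by (rule bdd_aboveI2[where M = "(L 2 + 2 * \<kappa>) / ln (real 2)"]) (use cmp[OF _ order_refl] in auto)
  have s1: "L n - \<kappa> \<le> s * ln n" if "n \<ge> 2" for n
  proof -
    have "(L n - \<kappa>) / ln n \<le> s"
      unfolding s_def using bdd that by (intro cSUP_upper) auto
    then show ?thesis using lnpos[OF that] by (simp add: field_simps)
  qed
  have s2: "s * ln m \<le> L m + 2 * \<kappa>" if "m \<ge> 2" for m
  proof -
    have "s \<le> (L m + 2 * \<kappa>) / ln m"
      unfolding s_def using that cmp by (intro cSUP_least) auto
    then show ?thesis using lnpos[OF that] by (simp add: field_simps)
  qed
  have ln2: "ln (real (2 ^ k)) = real k * ln 2" for k by (simp add: ln_realpow)
  \<comment> \<open>Along powers of 2, \<open>s2\<close> and \<open>upper\<close> bound all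
    multiples of this number. The exponent 0 is treated apart because \<open>s2\<close> starts at
    2.\<close>
  have "(s - 1) * ln 2 \<le> 0"
  proof (rule nonpos_if_multiples_bounded)
    fix k :: nat
    show "real k * ((s - 1) * ln 2) \<le> 3 * \<kappa>"
    proof (cases "k = 0")
      case False
      then have k: "(2::nat) \<le> 2 ^ k" using self_le_power[of "2::nat" k] by simp
      then show ?thesis using s2[OF k] upper[of "2 ^ k"] by (simp only: ln2) (simp add: algebra_simps)
    qed (use \<kappa> in simp)
  qed
  then have sle: "s \<le> 1" using lnpos[of 2] by (simp add: mult_le_0_iff)
  have "- s * ln 2 \<le> 0"
  proof (rule nonpos_if_multiples_bounded)
    fix k :: nat
    show "real k * (- s * ln 2) \<le> 3 * \<kappa>"
    proof (cases "k = 0")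
      case False
      then have k: "(2::nat) \<le> 2 ^ k" using self_le_power[of "2::nat" k] by simp
      then show ?thesis using s1[OF k] lower[of "2 ^ k"] by (simp only: ln2) (simp add: algebra_simps)
    qed (use \<kappa> in simp)
  qed
  then have sge: "0 \<le> s" using lnpos[of 2] by (simp add: mult_le_0_iff zero_le_mult_iff)
  show thesis
  proof (rule that[OF sge sle])
    fix n :: nat assume n: "n \<ge> 1"
    show "\<bar>L n - s * ln (real n)\<bar> \<le> 2 * \<kappa>"
    proof (cases "n = 1")
      case True
      then show ?thesis using L1 \<kappa> by simp
    next
      case False
      then show ?thesis using s1[of n] s2[of n] n \<kappa> by (simp add: abs_le_iff)
    qed
  qed
qed

text \<open>Logarithms turn multiplicative constants into the additive errors of
  \<open>quasi_additive_logarithmic\<close>; positivity of \<open>l\<close> forces \<open>K\<close>,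
  \<open>U\<close> and \<open>G\<close> to be positive.\<close>

lemma quasi_multiplicative_power_law:
  fixes l :: "nat \<Rightarrow> real"
  assumes pos: "\<And>n. n \<ge> 1 \<Longrightarrow> l n > 0"
    and mult: "\<And>m n. m \<ge> 1 \<Longrightarrow> n \<ge> 1 \<Longrightarrow> l (m * n) \<le> K * l m * l n"
      "\<And>m n. m \<ge> 1 \<Longrightarrow> n \<ge> 1 \<Longrightarrow> l m * l n \<le> K * l (m * n)"
    and mono: "\<And>m n. m \<ge> 1 \<Longrightarrow> m \<le> n \<Longrightarrow> l m \<le> U * l n"
    and upper: "\<And>n. n \<ge> 1 \<Longrightarrow> l n \<le> G * real n"
  obtains s D where "0 \<le> s" "s \<le> 1" "D > 0"
    "\<And>n. n \<ge> 1 \<Longrightarrow> l n \<le> D * real n powr s" "\<And>n. n \<ge> 1 \<Longrightarrow> real n powr s \<le> D * l n"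
proof -
  have pos_factor: "x > 0" if "0 < y" "y \<le> x * z" "0 < z" for x y z :: real
    using that by (meson less_le_trans zero_less_mult_pos2)
  have G: "G > 0" using pos_factor[OF pos[of 1] upper[of 1]] by simp
  have U: "U > 0" using pos_factor[OF pos[of 1] mono[of 1 1]] pos[of 1] by simp
  have K: "K > 0"
    using pos_factor[of "l 1 * l 1" K "l 1"] mult(2)[of 1 1] pos[of 1] by simp
  \<comment> \<open>One error term that dominates the logarithms of all three constants, whatever
    their signs.\<close>
  define \<kappa> where "\<kappa> = \<bar>ln K\<bar> + \<bar>ln U\<bar> + \<bar>ln G\<bar>"
  have ln_mono: "ln x \<le> ln y" if "0 < x" "x \<le> y" for x y :: real using that by simp
  obtain s where s: "0 \<le> s" "s \<le> 1"
    "\<And>n. n \<ge> 1 \<Longrightarrow> \<bar>ln (l n) - s * ln (real n)\<bar> \<le> 2 * \<kappa>"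
  proof (rule quasi_additive_logarithmic[of "\<lambda>n. ln (l n)" \<kappa>])
    fix m n :: nat assume mn: "m \<ge> 1" "n \<ge> 1"
    then have p: "l m > 0" "l n > 0" "l (m * n) > 0" by (auto intro!: pos)
    have "ln (l (m * n)) \<le> ln K + ln (l m) + ln (l n)"
      using ln_mono[OF p(3) mult(1)[OF mn]] p K by (simp add: ln_mult)
    moreover have "ln (l m) + ln (l n) \<le> ln K + ln (l (m * n))"
      using ln_mono[OF _ mult(2)[OF mn]] p K by (simp add: ln_mult)
    ultimately show "\<bar>ln (l (m * n)) - ln (l m) - ln (l n)\<bar> \<le> \<kappa>"
      unfolding \<kappa>_def by linarith
  next
    fix m n :: nat assume mn: "m \<ge> 1" "m \<le> n"
    then have p: "l m > 0" "l n > 0" by (auto intro!: pos)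
    show "ln (l m) \<le> ln (l n) + \<kappa>"
      using ln_mono[OF p(1) mono[OF mn]] p U unfolding \<kappa>_def by (simp add: ln_mult)
  next
    fix n :: nat assume n: "n \<ge> 1"
    show "ln (l n) \<le> ln (real n) + \<kappa>"
      using ln_mono[OF pos[OF n] upper[OF n]] G n unfolding \<kappa>_def by (simp add: ln_mult)
  qed (rule that)
  show ?thesis
  proof (rule that[OF s(1,2), of "exp (2 * \<kappa>)"])
    fix n :: nat assume n: "n \<ge> 1"
    have "l n = exp (ln (l n))" using pos[OF n] by simp
    also have "\<dots> \<le> exp (2 * \<kappa> + s * ln (real n))" using s(3)[OF n] by simp
    finally show "l n \<le> exp (2 * \<kappa>) * real n powr s" using n by (simp add: exp_add powr_def)
    have "real n powr s = exp (s * ln (real n))" using n by (simp add: powr_def)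
    also have "\<dots> \<le> exp (2 * \<kappa> + ln (l n))" using s(3)[OF n] by simp
    also have "\<dots> = exp (2 * \<kappa>) * l n" using pos[OF n] by (simp add: exp_add)
    finally show "real n powr s \<le> exp (2 * \<kappa>) * l n" .
  qed simp
qed

section \<open>Tensor powers of coefficient sequences\<close>

text \<open>For \<open>n > 0\<close>, the product of the \<open>a i\<close> over the
  \<open>k\<close> lowest base-\<open>n\<close> digits \<open>i\<close> of \<open>q\<close>. For
  \<open>q < n ^ k\<close> these are the coefficients of the \<open>k\<close>-fold \<otimes>-power
  of a vector with coefficients \<open>a 0, ..., a (n - 1)\<close> and
  \<open>a (n - 1) \<noteq> 0\<close>.\<close>

primrec tensor_power :: "nat \<Rightarrow> (nat \<Rightarrow> 'k::comm_semiring_1) \<Rightarrow> nat \<Rightarrow> nat \<Rightarrow> 'k" where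
  "tensor_power n a 0 = (\<lambda>_. 1)"
| "tensor_power n a (Suc k) = (\<lambda>q. tensor_power n a k (q div n) * a (q mod n))"

text \<open>Multiplication of scalars commutes, so only the number \<open>t j\<close> of occurrences
  of each digit \<open>j\<close> matters. Extensional functions make the set of exponent vectors
  finite.\<close>

lemma tensor_power_monomial:
  assumes "n > 0"
  shows "\<exists>t\<in>{..<n} \<rightarrow>\<^sub>E {..k}. tensor_power n a k q = (\<Prod>j<n. a j ^ t j)"
proof (induction k arbitrary: q)
  case 0
  show ?case by (rule bexI[of _ "\<lambda>j\<in>{..<n}. 0"]) auto
next
  case (Suc k)
  obtain t where t: "t \<in> {..<n} \<rightarrow>\<^sub>E {..k}" "tensor_power n a k (q div n) = (\<Prod>j<n. a j ^ t j)"
    using Suc by blast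
  define i where "i = q mod n"
  have i: "i < n" using assms by (simp add: i_def)
  have "(\<Prod>j<n. a j ^ (t(i := Suc (t i))) j) = (\<Prod>j<n. a j ^ t j) * a i"
  proof -
    have "(\<Prod>j<n. a j ^ (t(i := Suc (t i))) j) = (\<Prod>j<n. a j ^ t j * (if j = i then a j else 1))"
      by (intro prod.cong) (auto simp: mult.commute)
    also have "\<dots> = (\<Prod>j<n. a j ^ t j) * a i" using i by (simp add: prod.distrib)
    finally show ?thesis .
  qed
  moreover have "t(i := Suc (t i)) \<in> {..<n} \<rightarrow>\<^sub>E {..Suc k}"
    using t(1) i by (auto simp: PiE_iff extensional_def intro: le_SucI)
  ultimately show ?case using t(2) by (intro bexI[of _ "t(i := Suc (t i))"]) (simp_all add: i_def)
qed

lemma card_tensor_power_image: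
  assumes "n > 0"
  shows "real (card (tensor_power n a k ` A)) \<le> real (k + 1) ^ n"
proof -
  let ?P = "{..<n} \<rightarrow>\<^sub>E {..k}"
  have fin: "finite ?P" by (simp add: finite_PiE)
  have "tensor_power n a k ` A \<subseteq> (\<lambda>t. \<Prod>j<n. a j ^ t j) ` ?P"
    using tensor_power_monomial[OF assms] by blast
  then have "card (tensor_power n a k ` A) \<le> card ((\<lambda>t. \<Prod>j<n. a j ^ t j) ` ?P)"
    using fin by (intro card_mono) auto
  also have "\<dots> \<le> card ?P" by (rule card_image_le[OF fin])
  also have "\<dots> = (k + 1) ^ n" by (simp add: card_PiE)
  finally show ?thesis unfolding of_nat_power[symmetric] of_nat_le_iff .
qed

text \<open>The \<open>l_p\<close> norm is exactly multiplicative under \<otimes>, since the norm of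
  scalars is multiplicative.\<close>

lemma sum_norm_tensor_power:
  fixes a :: "nat \<Rightarrow> 'k::real_normed_field"
  shows "(\<Sum>q<n ^ k. norm (tensor_power n a k q) powr p) = (\<Sum>i<n. norm (a i) powr p) ^ k"
proof (induction k)
  case (Suc k)
  have "(\<Sum>q<n ^ k * n. norm (tensor_power n a k (q div n)) powr p * norm (a (q mod n)) powr p)
      = (\<Sum>i<n. norm (a i) powr p) ^ k * (\<Sum>i<n. norm (a i) powr p)"
    using sum_div_mod_mult[where g = "\<lambda>q. norm (tensor_power n a k q) powr p" and h = "\<lambda>j. norm (a j) powr p"]
    by (simp add: Suc)
  then show ?case by (simp add: norm_mult powr_mult mult.commute)
qed simp

lemma norm_tensor_power_le:
  fixes a :: "nat \<Rightarrow> 'k::real_normed_field"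
  assumes "\<And>i. norm (a i) \<le> B"
  shows "norm (tensor_power n a k q) \<le> B ^ k"
proof (induction k arbitrary: q)
  case (Suc k)
  have "0 \<le> B" using assms[of 0] norm_ge_zero order_trans by blast
  then have "norm (tensor_power n a k (q div n)) * norm (a (q mod n)) \<le> B ^ k * B"
    using Suc assms by (intro mult_mono) auto
  then show ?case by (simp add: norm_mult mult.commute)
qed simp

section \<open>The setting with fixed constants, and norms of coefficient sequences\<close>

locale multiplicative_spreading = banach_space_over smul
  for smul :: "'k::real_normed_field \<Rightarrow> 'a::banach \<Rightarrow> 'a" +
  fixes e :: "nat \<Rightarrow> 'a" and C K :: real
  assumes basic: "basic_sequence smul e"
    and C: "C > 0"
    and spread_lower: "strict_mono_on {..<n} k \<Longrightarrow>
      norm (\<Sum>i<n. smul (a i) (e i)) \<le> C * norm (\<Sum>i<n. smul (a i) (e (k i)))"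
    and spread_upper: "strict_mono_on {..<n} k \<Longrightarrow>
      norm (\<Sum>i<n. smul (a i) (e (k i))) \<le> C * norm (\<Sum>i<n. smul (a i) (e i))"
    and K: "K > 0"
    and tensor_lower: "\<alpha> \<in> span (range e) \<Longrightarrow> \<beta> \<in> span (range e) \<Longrightarrow>
      norm \<alpha> * norm \<beta> \<le> K * norm (tensor smul e \<alpha> \<beta>)"
    and tensor_upper: "\<alpha> \<in> span (range e) \<Longrightarrow> \<beta> \<in> span (range e) \<Longrightarrow>
      norm (tensor smul e \<alpha> \<beta>) \<le> K * norm \<alpha> * norm \<beta>"
begin

text \<open>The explicit length \<open>n\<close> replaces \<open>coord_length\<close> and leaves
  room for trailing zeros.\<close>

definition coef_norm :: "nat \<Rightarrow> (nat \<Rightarrow> 'k) \<Rightarrow> real" where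
  "coef_norm n a = norm (\<Sum>i<n. smul (a i) (e i))"

lemma coef_norm_nonneg [simp]: "0 \<le> coef_norm n a"
  by (simp add: coef_norm_def)

lemma coef_norm_pos:
  assumes "i < n" "a i \<noteq> 0"
  shows "0 < coef_norm n a"
proof -
  have "(\<Sum>i<n. smul (a i) (e i)) \<noteq> 0"
  proof
    assume eq: "(\<Sum>i<n. smul (a i) (e i)) = 0"
    have "coord smul e (\<Sum>i<n. smul (a i) (e i)) i = a i"
      using assms(1) by (simp add: coord_sum[OF basic])
    moreover have "coord smul e 0 i = 0" by (simp add: coord_def representation_zero)
    ultimately show False using eq assms(2) by simp
  qed
  then show ?thesis by (simp add: coef_norm_def)
qed

text \<open>The product has the coefficient \<open>a i * b j\<close> at index
  \<open>i * m + j\<close>. The condition on \<open>b (m - 1)\<close> ensures that \<otimes> uses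
  blocks of length exactly \<open>m\<close>; the left factor may end in zeros.\<close>

lemma coef_norm_tensor:
  assumes m: "m \<ge> 1" "b (m - 1) \<noteq> 0"
  shows "coef_norm n a * coef_norm m b \<le> K * coef_norm (n * m) (\<lambda>q. a (q div m) * b (q mod m))"
    and "coef_norm (n * m) (\<lambda>q. a (q div m) * b (q mod m)) \<le> K * coef_norm n a * coef_norm m b"
proof -
  let ?x = "\<Sum>i<n. smul (a i) (e i)" and ?y = "\<Sum>j<m. smul (b j) (e j)"
  have "tensor smul e ?x ?y = (\<Sum>q<n * m. smul (a (q div m) * b (q mod m)) (e q))"
    by (simp add: tensor_sum[OF basic, where b = b, OF m] sum_lessThan_mult scale_sum_right)
  moreover have "?x \<in> span (range e)" "?y \<in> span (range e)"
    by (intro span_sum span_scale span_base rangeI)+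
  ultimately show "coef_norm n a * coef_norm m b \<le> K * coef_norm (n * m) (\<lambda>q. a (q div m) * b (q mod m))"
    and "coef_norm (n * m) (\<lambda>q. a (q div m) * b (q mod m)) \<le> K * coef_norm n a * coef_norm m b"
    using tensor_lower[of ?x ?y] tensor_upper[of ?x ?y] by (simp_all add: coef_norm_def)
qed

lemma norm_e: "norm (e i) \<le> C * norm (e 0)" "norm (e 0) \<le> C * norm (e i)"
proof -
  have mono: "strict_mono_on {..<1::nat} (\<lambda>_. i)" by (auto simp: strict_mono_on_def)
  show "norm (e i) \<le> C * norm (e 0)" "norm (e 0) \<le> C * norm (e i)"
    using spread_upper[OF mono, of "\<lambda>_. 1"] spread_lower[OF mono, of "\<lambda>_. 1"] by simp_all
qed

lemma norm_e0_pos: "norm (e 0) > 0"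
  using coef_norm_pos[of 0 1 "\<lambda>_. 1"] by (simp add: coef_norm_def)

section \<open>Suppression unconditionality\<close>

text \<open>Each difference gets its own block of \<open>M + 1\<close> positions. Averaging over
  \<open>M\<close> shifts of the differences outside \<open>S\<close> fixes those in
  \<open>S\<close>, while the others telescope to \<open>1 / M\<close> times the difference of the
  two block ends. Spreading out and back costs \<open>C * C\<close>.\<close>

lemma norm_differences_suppression:
  defines "d \<equiv> \<lambda>a n. \<Sum>i<n. smul (a i) (e (2 * i) - e (2 * i + 1))"
  shows "norm (d (\<lambda>i. if i \<in> S then a i else 0) n) \<le> C * C * norm (d a n)"
proof -
  let ?sgn = "\<lambda>q::nat. if even q then 1 else - 1 :: 'k"
  have pairs: "(\<Sum>i<n. smul (b i) (x (2 * i) - x (2 * i + 1))) =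
      (\<Sum>q<n * 2. smul (b (q div 2) * ?sgn q) (x q))" for b :: "nat \<Rightarrow> 'k" and x
    by (simp add: sum_lessThan_mult sum_lessThan_2 scale_right_diff_distrib mult.commute)
  have lower: "norm (d b n) \<le> C * norm (\<Sum>i<n. smul (b i) (e (k (2 * i)) - e (k (2 * i + 1))))"
    and upper: "norm (\<Sum>i<n. smul (b i) (e (k (2 * i)) - e (k (2 * i + 1)))) \<le> C * norm (d b n)"
    if "strict_mono k" for b k
  proof -
    have "strict_mono_on {..<n * 2} k" using that by (simp add: strict_mono_on_def strict_monoD)
    then show "norm (d b n) \<le> C * norm (\<Sum>i<n. smul (b i) (e (k (2 * i)) - e (k (2 * i + 1))))"
      "norm (\<Sum>i<n. smul (b i) (e (k (2 * i)) - e (k (2 * i + 1)))) \<le> C * norm (d b n)"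
      unfolding d_def pairs[of b e] pairs[of b "\<lambda>q. e (k q)"]
      by (rule spread_lower, rule spread_upper)
  qed
  let ?aS = "\<lambda>i. if i \<in> S then a i else 0"
  define E where "E = (\<Sum>i<n. norm (a i) * (2 * (C * norm (e 0))))"
  \<comment> \<open>\<open>E\<close> bounds the telescoped remainder independently of
    \<open>M\<close>, so it disappears as \<open>M\<close> grows.\<close>
  have M: "real M * (norm (d ?aS n) - C * C * norm (d a n)) \<le> C * E" for M
  proof (cases "M = 0")
    case True
    then show ?thesis using C by (auto simp: E_def intro!: sum_nonneg mult_nonneg_nonneg)
  next
    case False
    \<comment> \<open>In block \<open>q div 2\<close> the pair occupies offsets 0 and 1 if the block
      belongs to \<open>S\<close>, and \<open>l\<close> and \<open>l + 1\<close> otherwise;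
      \<open>l < M\<close> keeps it inside the block.\<close>
    define pos where "pos l q = (q div 2) * (M + 1) + (if q div 2 \<in> S then 0 else l) + q mod 2"
      for l q :: nat
    have mono: "strict_mono (pos l)" if "l < M" for l
      unfolding strict_mono_Suc_iff
    proof
      fix q
      show "pos l q < pos l (Suc q)"
      proof (cases "even q")
        case True
        then obtain i where "q = 2 * i" by (elim evenE)
        then show ?thesis by (simp add: pos_def)
      next
        case False
        then obtain i where "q = 2 * i + 1" by (elim oddE)
        then show ?thesis using that by (auto simp: pos_def)
      qed
    qed
    define v where "v l = (\<Sum>i<n. smul (a i) (e (pos l (2 * i)) - e (pos l (2 * i + 1))))" for l
    define w where "w = (\<Sum>i<n. smul (?aS i) (e (pos 0 (2 * i)) - e (pos 0 (2 * i + 1))))"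
    define r where "r = (\<Sum>i<n. smul (if i \<in> S then 0 else a i) (e (i * (M + 1)) - e (i * (M + 1) + M)))"
    have "(\<Sum>l<M. v l) = (\<Sum>i<n. smul (a i) (\<Sum>l<M. e (pos l (2 * i)) - e (pos l (2 * i + 1))))"
      unfolding v_def scale_sum_right by (rule sum.swap)
    also have "\<dots> = (\<Sum>i<n. real M *\<^sub>R smul (?aS i) (e (pos 0 (2 * i)) - e (pos 0 (2 * i + 1)))
        + smul (if i \<in> S then 0 else a i) (e (i * (M + 1)) - e (i * (M + 1) + M)))"
    proof (intro sum.cong refl)
      fix i
      have tele: "(\<Sum>l<M. e (x + l) - e (Suc (x + l))) = e x - e (x + M)" for x
        using sum_lessThan_telescope'[of "\<lambda>l. e (x + l)" M] by simp
      have "Suc (i * 2) mod 2 = 1" by presburger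
      then show "smul (a i) (\<Sum>l<M. e (pos l (2 * i)) - e (pos l (2 * i + 1))) =
          real M *\<^sub>R smul (?aS i) (e (pos 0 (2 * i)) - e (pos 0 (2 * i + 1)))
        + smul (if i \<in> S then 0 else a i) (e (i * (M + 1)) - e (i * (M + 1) + M))"
        using tele[of "i * (M + 1)"]
        by (simp add: pos_def sum_constant_scaleR scale_of_real[symmetric] mult.commute)
    qed
    also have "\<dots> = real M *\<^sub>R w + r"
      by (simp add: w_def r_def sum.distrib scaleR_sum_right)
    finally have eq: "real M *\<^sub>R w = (\<Sum>l<M. v l) - r" by simp
    have "norm (v l) \<le> C * norm (d a n)" if "l < M" for l
      unfolding v_def by (rule upper[OF mono[OF that]])
    then have "norm (\<Sum>l<M. v l) \<le> real M * (C * norm (d a n))"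
      using sum_norm_bound[of "{..<M}" v] by simp
    moreover have "norm r \<le> E"
      unfolding r_def E_def
    proof (intro sum_norm_le)
      fix i
      have "norm (e x - e y) \<le> 2 * (C * norm (e 0))" for x y
        using norm_triangle_ineq4[of "e x" "e y"] norm_e(1)[of x] norm_e(1)[of y] by linarith
      then show "norm (smul (if i \<in> S then 0 else a i) (e (i * (M + 1)) - e (i * (M + 1) + M)))
          \<le> norm (a i) * (2 * (C * norm (e 0)))"
        using C by (simp add: norm_scale mult_left_mono)
    qed
    ultimately have "real M * norm w \<le> real M * (C * norm (d a n)) + E"
      using norm_triangle_ineq4[of "\<Sum>l<M. v l" r] arg_cong[OF eq, of norm] by simp
    moreover have "norm (d ?aS n) \<le> C * norm w"
      unfolding w_def by (rule lower[OF mono]) (use False in simp)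
    then have "real M * norm (d ?aS n) \<le> C * (real M * norm w)"
      using mult_left_mono[of "norm (d ?aS n)" "C * norm w" "real M"] by (simp add: algebra_simps)
    ultimately have "real M * norm (d ?aS n) \<le> C * (real M * (C * norm (d a n)) + E)"
      using C by (elim order_trans) (simp add: mult_left_mono)
    then show ?thesis by (simp add: algebra_simps)
  qed
  show ?thesis using nonpos_if_multiples_bounded[OF M] by simp
qed

definition U :: real where "U = C * C * K * K"

lemma U: "U > 0" using C K by (simp add: U_def)

text \<open>Tensoring with \<open>e 0 - e 1\<close> turns \<open>e i\<close> into
  \<open>e (2 * i) - e (2 * i + 1)\<close>, where suppression is known. Passing to the differences
  and back costs \<open>K\<close> each time, and the positive norm of \<open>e 0 - e 1\<close>
  cancels.\<close>

lemma coef_norm_suppression: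
  "coef_norm n (\<lambda>i. if i \<in> S then a i else 0) \<le> U * coef_norm n a"
proof -
  define b :: "nat \<Rightarrow> 'k" where "b j = (if j = 0 then 1 else - 1)" for j
  define d where "d a = (\<Sum>i<n. smul (a i) (e (2 * i) - e (2 * i + 1)))" for a
  have diff: "coef_norm (n * 2) (\<lambda>q. c (q div 2) * b (q mod 2)) = norm (d c)" for c
    by (simp add: coef_norm_def d_def b_def sum_lessThan_mult sum_lessThan_2
        scale_right_diff_distrib mult.commute)
  have t: "coef_norm n c * coef_norm 2 b \<le> K * norm (d c)"
    "norm (d c) \<le> K * coef_norm n c * coef_norm 2 b" for c
    using coef_norm_tensor[of 2 b n c] by (simp_all add: b_def diff[unfolded b_def])
  let ?aS = "\<lambda>i. if i \<in> S then a i else 0"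
  have "coef_norm n ?aS * coef_norm 2 b \<le> K * norm (d ?aS)" by (rule t)
  also have "\<dots> \<le> K * (C * C * norm (d a))"
    using norm_differences_suppression[of S a n] K by (intro mult_left_mono) (auto simp: d_def)
  also have "\<dots> \<le> K * (C * C * (K * coef_norm n a * coef_norm 2 b))"
    using t(2)[of a] K C by (intro mult_left_mono) auto
  also have "\<dots> = U * coef_norm n a * coef_norm 2 b" by (simp add: U_def)
  finally show ?thesis
    using coef_norm_pos[of 0 2 b] by (simp add: b_def)
qed

section \<open>The fundamental function of the basis\<close>

definition fund :: "nat \<Rightarrow> real" where "fund n = norm (\<Sum>i<n. e i)"

lemma fund_eq: "fund n = coef_norm n (\<lambda>_. 1)"
  by (simp add: fund_def coef_norm_def)

lemma norm_sum_e:
  assumes "finite A"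
  shows "norm (\<Sum>i\<in>A. e i) \<le> C * fund (card A)" "fund (card A) \<le> C * norm (\<Sum>i\<in>A. e i)"
proof -
  obtain h where h: "bij_betw h {..<card A} A" "strict_mono_on {..<card A} h"
    using ex_bij_betw_strict_mono_card[OF assms] by blast
  have "(\<Sum>i<card A. e (h i)) = (\<Sum>i\<in>A. e i)"
    by (rule sum.reindex_bij_betw[OF h(1)])
  then show "norm (\<Sum>i\<in>A. e i) \<le> C * fund (card A)" "fund (card A) \<le> C * norm (\<Sum>i\<in>A. e i)"
    using spread_upper[OF h(2), of "\<lambda>_. 1"] spread_lower[OF h(2), of "\<lambda>_. 1"]
    by (simp_all add: fund_def)
qed

text \<open>The product of the all-ones vectors of lengths \<open>m\<close> and \<open>n\<close> is
  the one of length \<open>m * n\<close>. Suppression gives monotonicity up to \<open>U\<close>, and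
  the triangle inequality gives linear growth.\<close>

lemma fund_power_law:
  obtains s D where "0 \<le> s" "s \<le> 1" "D > 0"
    "\<And>n. n \<ge> 1 \<Longrightarrow> fund n \<le> D * real n powr s" "\<And>n. n \<ge> 1 \<Longrightarrow> real n powr s \<le> D * fund n"
proof (rule quasi_multiplicative_power_law[of fund K U "C * norm (e 0)"])
  fix m n :: nat assume mn: "m \<ge> 1" "n \<ge> 1"
  show "fund (m * n) \<le> K * fund m * fund n" "fund m * fund n \<le> K * fund (m * n)"
    using coef_norm_tensor[of n "\<lambda>_. 1" m "\<lambda>_. 1"] mn by (simp_all add: fund_eq)
next
  fix n :: nat assume "n \<ge> 1"
  then show "0 < fund n" unfolding fund_eq by (intro coef_norm_pos[of 0]) auto
next
  fix m n :: nat assume "m \<le> n"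
  then have "coef_norm n (\<lambda>i. if i \<in> {..<m} then 1 else 0) = fund m"
    unfolding coef_norm_def fund_def
    by (intro arg_cong[of _ _ norm] sum.mono_neutral_cong_right) auto
  then show "fund m \<le> U * fund n"
    using coef_norm_suppression[of n "{..<m}" "\<lambda>_. 1"] by (simp add: fund_eq)
next
  fix n :: nat
  show "fund n \<le> C * norm (e 0) * real n"
    unfolding fund_def using sum_norm_bound[of "{..<n}" e, OF norm_e(1)] by (simp add: mult.commute)
qed (rule that)

section \<open>Norm estimates from level sets of tensor powers\<close>

text \<open>Each further factor \<open>a\<close> on the right costs one \<open>K\<close>; the power
  0 is the vector \<open>e 0\<close>.\<close>

lemma coef_norm_tensor_power:
  assumes n: "n \<ge> 1" "a (n - 1) \<noteq> 0"
  shows "coef_norm n a ^ k * norm (e 0) \<le> K ^ k * coef_norm (n ^ k) (tensor_power n a k)"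
    and "coef_norm (n ^ k) (tensor_power n a k) \<le> K ^ k * coef_norm n a ^ k * norm (e 0)"
proof (induction k)
  case 0
  { case 1 show ?case by (simp add: coef_norm_def) }
  { case 2 show ?case by (simp add: coef_norm_def) }
next
  case (Suc k)
  let ?N = "coef_norm (n ^ k) (tensor_power n a k)"
  note t = coef_norm_tensor[where b = a, OF n, where n = "n ^ k" and a = "tensor_power n a k"]
  have eq: "n ^ Suc k = n ^ k * n" by simp
  { case 1
    have "coef_norm n a * (coef_norm n a ^ k * norm (e 0)) \<le> coef_norm n a * (K ^ k * ?N)"
      using Suc(1) by (intro mult_left_mono) auto
    also have "\<dots> = K ^ k * (?N * coef_norm n a)" by simp
    also have "\<dots> \<le> K ^ k * (K * coef_norm (n ^ Suc k) (tensor_power n a (Suc k)))"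
      unfolding eq using t(1) K by (intro mult_left_mono) auto
    finally show ?case by (simp add: mult_ac) }
  { case 2
    have "coef_norm (n ^ Suc k) (tensor_power n a (Suc k)) \<le> K * ?N * coef_norm n a"
      unfolding eq using t(2) by simp
    also have "\<dots> \<le> K * (K ^ k * coef_norm n a ^ k * norm (e 0)) * coef_norm n a"
      using Suc(2) K by (intro mult_left_mono mult_right_mono) auto
    finally show ?case by (simp add: mult_ac) }
qed

text \<open>Grouping equal coefficients and the triangle inequality reduce the norm to sums of basis
  vectors over level sets, which \<open>fund\<close> controls. The loss is the number of distinct
  values.\<close>

lemma coef_norm_level_sets:
  assumes D: "\<And>n. n \<ge> 1 \<Longrightarrow> fund n \<le> D * real n powr s"
    and Z: "\<And>v. v \<in> c ` {..<n} \<Longrightarrow> norm v * real (card {q \<in> {..<n}. c q = v}) powr s \<le> Z"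
    and "D \<ge> 0"
  shows "coef_norm n c \<le> C * D * real (card (c ` {..<n})) * Z"
proof -
  let ?A = "\<lambda>v. {q \<in> {..<n}. c q = v}"
  have finA: "finite (?A v)" for v by simp
  have "(\<Sum>q<n. smul (c q) (e q)) = (\<Sum>v\<in>c ` {..<n}. smul v (\<Sum>q\<in>?A v. e q))"
    by (subst sum.image_gen[of _ _ c]) (auto simp: scale_sum_right)
  then have "coef_norm n c \<le> (\<Sum>v\<in>c ` {..<n}. norm (smul v (\<Sum>q\<in>?A v. e q)))"
    unfolding coef_norm_def by (metis norm_sum)
  also have "\<dots> \<le> real (card (c ` {..<n})) * (C * D * Z)"
  proof (rule sum_bounded_above)
    fix v assume v: "v \<in> c ` {..<n}"
    then have ne: "card (?A v) \<ge> 1" by (auto simp: Suc_le_eq card_gt_0_iff)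
    have "norm (\<Sum>q\<in>?A v. e q) \<le> C * (D * real (card (?A v)) powr s)"
      using C by (intro order_trans[OF norm_sum_e(1)[OF finA]] mult_left_mono D ne) auto
    then have "norm v * norm (\<Sum>q\<in>?A v. e q) \<le> norm v * (C * (D * real (card (?A v)) powr s))"
      by (intro mult_left_mono) auto
    also have "\<dots> = C * D * (norm v * real (card (?A v)) powr s)" by simp
    also have "\<dots> \<le> C * D * Z" using Z[OF v] C \<open>D \<ge> 0\<close> by (intro mult_left_mono) auto
    finally show "norm (smul v (\<Sum>q\<in>?A v. e q)) \<le> C * D * Z" by (simp add: norm_scale)
  qed
  finally show ?thesis by (simp add: mult_ac)
qed

text \<open>The converse for a single level set: suppress all coefficients outside it.\<close>

lemma level_set_le_coef_norm:
  assumes D: "\<And>n. n \<ge> 1 \<Longrightarrow> real n powr s \<le> D * fund n" "D > 0"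
    and v: "v \<in> c ` {..<n}"
  shows "norm v * real (card {q \<in> {..<n}. c q = v}) powr s \<le> D * C * U * coef_norm n c"
proof -
  let ?A = "{q \<in> {..<n}. c q = v}"
  have finA: "finite ?A" by simp
  have ne: "card ?A \<ge> 1" using v by (auto simp: Suc_le_eq card_gt_0_iff)
  have "real (card ?A) powr s \<le> D * (C * norm (\<Sum>q\<in>?A. e q))"
    using D(2) by (intro order_trans[OF D(1)[OF ne]] mult_left_mono norm_sum_e(2)[OF finA]) auto
  then have "norm v * real (card ?A) powr s \<le> norm v * (D * (C * norm (\<Sum>q\<in>?A. e q)))"
    by (intro mult_left_mono) auto
  also have "\<dots> = D * C * norm (smul v (\<Sum>q\<in>?A. e q))" by (simp add: norm_scale)
  also have "smul v (\<Sum>q\<in>?A. e q) = (\<Sum>q<n. smul (if q \<in> ?A then c q else 0) (e q))"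
    unfolding scale_sum_right by (rule sum.mono_neutral_cong_left) auto
  also have "D * C * norm \<dots> \<le> D * C * (U * coef_norm n c)"
    using coef_norm_suppression[of n ?A c] D C by (intro mult_left_mono) (auto simp: coef_norm_def)
  finally show ?thesis by simp
qed

text \<open>A tensor power has at most \<open>(k + 1) ^ n\<close> distinct coefficients, so the loss
  from grouping disappears under \<open>k\<close>-th roots, as do \<open>C\<close>, \<open>D\<close>
  and \<open>norm (e 0)\<close>; only the factor \<open>K\<close> per tensoring survives.\<close>

lemma coef_norm_le_of_level_sets:
  assumes n: "n \<ge> 1" "a (n - 1) \<noteq> 0"
    and D: "\<And>n. n \<ge> 1 \<Longrightarrow> fund n \<le> D * real n powr s" "D \<ge> 0"
    and B: "B \<ge> 0"
    and level: "\<And>k v. norm v * real (card {q \<in> {..<n ^ k}. tensor_power n a k q = v}) powr s \<le> B ^ k"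
  shows "coef_norm n a \<le> K * B"
proof (rule le_if_powers_le_polynomial)
  fix k
  have "coef_norm n a ^ k * norm (e 0) \<le> K ^ k * coef_norm (n ^ k) (tensor_power n a k)"
    by (rule coef_norm_tensor_power[where a = a, OF n])
  also have "\<dots> \<le> K ^ k * (C * D * real (card (tensor_power n a k ` {..<n ^ k})) * B ^ k)"
    using K by (intro mult_left_mono coef_norm_level_sets[OF D(1) level D(2)]) auto
  also have "\<dots> \<le> K ^ k * (C * D * real (k + 1) ^ n * B ^ k)"
    using K C D(2) B n
    by (intro mult_left_mono mult_right_mono card_tensor_power_image) auto
  finally show "coef_norm n a ^ k \<le> C * D / norm (e 0) * real (k + 1) ^ n * (K * B) ^ k"
    using norm_e0_pos by (simp add: field_simps power_mult_distrib)
qed (use K B in simp)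

lemma coef_norm_ge_coeff:
  assumes "i < n"
  shows "norm (a i) \<le> C * U / norm (e 0) * coef_norm n a"
proof -
  have "norm (a i) * norm (e 0) \<le> norm (a i) * (C * norm (e i))"
    by (intro mult_left_mono norm_e) auto
  also have "\<dots> = C * coef_norm n (\<lambda>j. if j \<in> {i} then a j else 0)"
  proof -
    have "(\<Sum>j<n. smul (if j \<in> {i} then a j else 0) (e j)) = (\<Sum>j\<in>{i}. smul (a j) (e j))"
      using assms by (intro sum.mono_neutral_cong_right) auto
    then show ?thesis by (simp add: coef_norm_def norm_scale)
  qed
  also have "\<dots> \<le> C * (U * coef_norm n a)"
    using C by (intro mult_left_mono coef_norm_suppression) auto
  finally show ?thesis using norm_e0_pos by (simp add: field_simps)
qed

text \<open>With \<open>p = 1 / s\<close>, one level set contributes at most the whole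
  \<open>l_p\<close> sum of the tensor power, which gives the upper bound. Conversely that sum
  splits into at most \<open>(k + 1) ^ n\<close> level sets, each dominated by the norm.\<close>

lemma coef_norm_lp:
  assumes n: "n \<ge> 1" "a (n - 1) \<noteq> 0"
    and s: "0 < s" "s \<le> 1"
    and D: "D > 0" "\<And>n. n \<ge> 1 \<Longrightarrow> fund n \<le> D * real n powr s"
      "\<And>n. n \<ge> 1 \<Longrightarrow> real n powr s \<le> D * fund n"
  defines "B \<equiv> (\<Sum>i<n. norm (a i) powr (1 / s)) powr s"
  shows "coef_norm n a \<le> K * B" "B \<le> K * coef_norm n a"
proof -
  define Q where "Q = (\<Sum>i<n. norm (a i) powr (1 / s))"
  have Q: "Q \<ge> 0" by (auto simp: Q_def intro: sum_nonneg)
  have B: "B = Q powr s" "B \<ge> 0" by (simp_all add: B_def Q_def)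
  have Bk: "B ^ k = (Q ^ k) powr s" for k
  proof (cases "Q = 0")
    case True
    then show ?thesis using B by (cases k) auto
  next
    case False
    then have "Q > 0" using Q by simp
    then show ?thesis by (simp add: B powr_realpow[symmetric] powr_powr mult.commute)
  qed
  let ?c = "\<lambda>k. tensor_power n a k"
  let ?A = "\<lambda>k v. {q \<in> {..<n ^ k}. ?c k q = v}"
  \<comment> \<open>Raised to the power \<open>1 / s\<close>, the quantity in the level set
    estimates is exactly the contribution of the level set to the \<open>l_p\<close> sum.\<close>
  have level_power: "(norm v * real (card (?A k v)) powr s) powr (1 / s)
      = (\<Sum>q\<in>?A k v. norm (?c k q) powr (1 / s))" for k v
    using s by (simp add: powr_mult powr_powr mult.commute)
  show "coef_norm n a \<le> K * B"
  proof (rule coef_norm_le_of_level_sets[where a = a, OF n D(2) less_imp_le[OF D(1)] B(2)])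
    fix k v
    have "(norm v * real (card (?A k v)) powr s) powr (1 / s) \<le> Q ^ k"
      unfolding level_power Q_def sum_norm_tensor_power[symmetric]
      by (intro sum_mono2) auto
    then have "((norm v * real (card (?A k v)) powr s) powr (1 / s)) powr s \<le> (Q ^ k) powr s"
      using s by (intro powr_mono2) auto
    then show "norm v * real (card (?A k v)) powr s \<le> B ^ k"
      unfolding Bk using s by (simp add: powr_powr)
  qed
  show "B \<le> K * coef_norm n a"
  proof (rule le_if_powers_le_polynomial)
    fix k
    define Z where "Z = D * C * U * coef_norm (n ^ k) (?c k)"
    have Z: "Z \<ge> 0" using D C U by (simp add: Z_def)
    let ?m = "real (k + 1) ^ n"
    have m: "1 \<le> ?m" by simp
    have "Q ^ k = (\<Sum>q<n ^ k. norm (?c k q) powr (1 / s))"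
      by (simp add: Q_def sum_norm_tensor_power)
    also have "\<dots> = (\<Sum>v\<in>?c k ` {..<n ^ k}. \<Sum>q\<in>?A k v. norm (?c k q) powr (1 / s))"
      by (rule sum.image_gen) simp
    also have "\<dots> \<le> real (card (?c k ` {..<n ^ k})) * Z powr (1 / s)"
    proof (rule sum_bounded_above)
      fix v assume "v \<in> ?c k ` {..<n ^ k}"
      then show "(\<Sum>q\<in>?A k v. norm (?c k q) powr (1 / s)) \<le> Z powr (1 / s)"
        unfolding level_power[symmetric] Z_def using s
        by (intro powr_mono2 level_set_le_coef_norm D) auto
    qed
    also have "\<dots> \<le> ?m * Z powr (1 / s)"
      using n by (intro mult_right_mono card_tensor_power_image) auto
    finally have "B ^ k \<le> (?m * Z powr (1 / s)) powr s"
      unfolding Bk using s Q by (intro powr_mono2) auto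
    also have "\<dots> = ?m powr s * Z"
      using s Z by (simp add: powr_mult powr_powr)
    \<comment> \<open>\<open>s \<le> 1 \<le> ?m\<close> replaces the real power by a polynomial in
      \<open>k\<close> of degree \<open>n\<close>.\<close>
    also have "\<dots> \<le> ?m * Z"
      using powr_mono[OF s(2) m] m Z by (intro mult_right_mono) auto
    also have "\<dots> \<le> ?m * (D * C * U * (K ^ k * coef_norm n a ^ k * norm (e 0)))"
      unfolding Z_def using D C U coef_norm_tensor_power(2)[where a = a, OF n] by (intro mult_left_mono) auto
    finally show "B ^ k \<le> D * C * U * norm (e 0) * real (k + 1) ^ n * (K * coef_norm n a) ^ k"
      by (simp add: power_mult_distrib mult_ac)
  qed (use K in simp)
qed

lemma coef_norm_c0:
  assumes n: "n \<ge> 1" "a (n - 1) \<noteq> 0"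
    and D: "D > 0" "\<And>n. n \<ge> 1 \<Longrightarrow> fund n \<le> D"
    and B: "\<And>i. norm (a i) \<le> B"
  shows "coef_norm n a \<le> K * B"
proof -
  have B0: "B \<ge> 0" using B[of 0] norm_ge_zero order_trans by blast
  show ?thesis
  proof (rule coef_norm_le_of_level_sets[where a = a, OF n, where D = D and s = 0])
    fix k v
    \<comment> \<open>Here \<open>0 powr 0 = 0\<close> disposes of empty level sets; a nonempty one
      contributes just \<open>norm v\<close>.\<close>
    show "norm v * real (card {q \<in> {..<n ^ k}. tensor_power n a k q = v}) powr 0 \<le> B ^ k"
    proof (cases "{q \<in> {..<n ^ k}. tensor_power n a k q = v} = {}")
      case True
      then show ?thesis using B0 by simp
    next
      case False
      then show ?thesis using norm_tensor_power_le[of a B n k] B by auto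
    qed
  qed (use D B0 in auto)
qed

section \<open>Equivalence with the unit vector bases\<close>

text \<open>Taking \<open>n\<close> one past the last nonzero index provides the nonzero last
  coefficient that the tensor estimates require; the zero sequence has none and is covered by
  \<open>zero\<close>.\<close>

lemma equivalent_sequencesI:
  assumes D: "D > 0"
    and zero: "N' 0 = 0"
    and bound: "\<And>n a. n \<ge> 1 \<Longrightarrow> a (n - 1) \<noteq> 0 \<Longrightarrow> (\<And>i. i \<ge> n \<Longrightarrow> a i = 0) \<Longrightarrow>
      coef_norm n a \<le> D * N' a \<and> N' a \<le> D * coef_norm n a"
  shows "equivalent_sequences norm smul e N' seq_scale unit_vec"
  unfolding equivalent_sequences_def
proof (intro exI conjI allI impI)
  fix a :: "nat \<Rightarrow> 'k" assume fin: "finite {i. a i \<noteq> 0}"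
  have sum_apply: "(\<Sum>i\<in>T. f i) j = (\<Sum>i\<in>T. f i j)" if "finite T" for T and f :: "nat \<Rightarrow> nat \<Rightarrow> 'k" and j
    using that by induction auto
  have unit: "(\<Sum>i | a i \<noteq> 0. seq_scale (a i) (unit_vec i)) = a"
  proof
    fix j
    have "(\<Sum>i | a i \<noteq> 0. seq_scale (a i) (unit_vec i)) j = (\<Sum>i | a i \<noteq> 0. if j = i then a i else 0)"
      by (simp add: sum_apply[OF fin] seq_scale_def unit_vec_def if_distrib cong: if_cong)
    then show "(\<Sum>i | a i \<noteq> 0. seq_scale (a i) (unit_vec i)) j = a j"
      using fin by simp
  qed
  have "1 / D * norm (\<Sum>i | a i \<noteq> 0. smul (a i) (e i)) \<le> N' a \<and>
      N' a \<le> D * norm (\<Sum>i | a i \<noteq> 0. smul (a i) (e i))"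
  proof (cases "{i. a i \<noteq> 0} = {}")
    case True
    then have "a = 0" by auto
    with zero show ?thesis by simp
  next
    case False
    define n where "n = Suc (Max {i. a i \<noteq> 0})"
    have n: "n \<ge> 1" "a (n - 1) \<noteq> 0" using Max_in[OF fin False] by (auto simp: n_def)
    have supp: "a i = 0" if "i \<ge> n" for i
      using Max_ge[OF fin, of i] that by (auto simp: n_def)
    have "norm (\<Sum>i | a i \<noteq> 0. smul (a i) (e i)) = coef_norm n a"
      unfolding coef_norm_def using supp not_le
      by (intro arg_cong[of _ _ norm] sum.mono_neutral_left) auto
    then show ?thesis using bound[where a = a, OF n supp] D by (simp add: field_simps)
  qed
  then show "1 / D * norm (\<Sum>i | a i \<noteq> 0. smul (a i) (e i)) \<le> N' (\<Sum>i | a i \<noteq> 0. seq_scale (a i) (unit_vec i))"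
    and "N' (\<Sum>i | a i \<noteq> 0. seq_scale (a i) (unit_vec i)) \<le> D * norm (\<Sum>i | a i \<noteq> 0. smul (a i) (e i))"
    unfolding unit by simp_all
qed (rule D)

lemma equivalent_to_c0_or_lp:
  "equivalent_to_c0_basis smul e \<or> (\<exists>p\<ge>1. equivalent_to_lp_basis p smul e)"
proof -
  obtain s D where s: "0 \<le> s" "s \<le> 1" and D: "D > 0"
    "\<And>n. n \<ge> 1 \<Longrightarrow> fund n \<le> D * real n powr s" "\<And>n. n \<ge> 1 \<Longrightarrow> real n powr s \<le> D * fund n"
    using fund_power_law by blast
  show ?thesis
  proof (cases "s = 0")
    case True
    have F: "fund n \<le> D" if "n \<ge> 1" for n using D(2)[OF that] that True by simp
    \<comment> \<open>The norm dominates the supremum of the coefficients by suppression to single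
      coordinates; the opposite estimate, with constant \<open>K\<close>, uses tensor powers. The
      sum \<open>K + ?R\<close> serves both.\<close>
    let ?R = "C * U / norm (e 0)"
    have R: "?R \<ge> 0" using C U by simp
    have "equivalent_to_c0_basis smul e"
      unfolding equivalent_to_c0_basis_def
    proof (rule equivalent_sequencesI[where D = "K + ?R"])
      show "0 < K + ?R" using K R by simp
      show "c0_norm (0 :: nat \<Rightarrow> 'k) = 0" by (simp add: c0_norm_def)
      fix n and a :: "nat \<Rightarrow> 'k"
      assume n: "n \<ge> 1" "a (n - 1) \<noteq> 0" and supp: "\<And>i. i \<ge> n \<Longrightarrow> a i = 0"
      have le: "norm (a i) \<le> ?R * coef_norm n a" for i
        using coef_norm_ge_coeff[of i n a] supp[of i] mult_nonneg_nonneg[OF R coef_norm_nonneg]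
        by (cases "i < n") auto
      have "norm (a i) \<le> c0_norm a" for i
        unfolding c0_norm_def by (rule cSUP_upper[OF _ bdd_aboveI2[OF le]]) simp
      then have "coef_norm n a \<le> K * c0_norm a" and "0 \<le> c0_norm a"
        using coef_norm_c0[where a = a, OF n D(1) F] norm_ge_zero order_trans by blast+
      moreover have "c0_norm a \<le> ?R * coef_norm n a"
        unfolding c0_norm_def by (rule cSUP_least) (use le in auto)
      moreover have "0 \<le> ?R * c0_norm a" "0 \<le> K * coef_norm n a"
        using \<open>0 \<le> c0_norm a\<close> K R by (intro mult_nonneg_nonneg; simp)+
      ultimately show "coef_norm n a \<le> (K + ?R) * c0_norm a \<and> c0_norm a \<le> (K + ?R) * coef_norm n a"
        unfolding distrib_right by linarith
    qed
    then show ?thesis ..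
  next
    case False
    with s have s: "0 < s" "s \<le> 1" by auto
    have "equivalent_to_lp_basis (1 / s) smul e"
      unfolding equivalent_to_lp_basis_def
    proof (rule equivalent_sequencesI[OF K])
      show "lp_norm (1 / s) (0 :: nat \<Rightarrow> 'k) = 0" by (simp add: lp_norm_def)
      fix n and a :: "nat \<Rightarrow> 'k"
      assume n: "n \<ge> 1" "a (n - 1) \<noteq> 0" and supp: "\<And>i. i \<ge> n \<Longrightarrow> a i = 0"
      have "(\<Sum>i. norm (a i) powr (1 / s)) = (\<Sum>i<n. norm (a i) powr (1 / s))"
        using supp by (intro suminf_finite) auto
      then have "lp_norm (1 / s) a = (\<Sum>i<n. norm (a i) powr (1 / s)) powr s"
        by (simp add: lp_norm_def)
      then show "coef_norm n a \<le> K * lp_norm (1 / s) a \<and> lp_norm (1 / s) a \<le> K * coef_norm n a"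
        using coef_norm_lp[where a = a, OF n s D] by simp
    qed
    moreover have "1 \<le> 1 / s" using s by simp
    ultimately show ?thesis by blast
  qed
qed

end

theorem theorem13:
  fixes smul :: "'k::real_normed_field \<Rightarrow> 'a::banach \<Rightarrow> 'a"
    and e :: "nat \<Rightarrow> 'a"
  assumes "banach_space_over smul"
    and "basic_sequence smul e"
    and "invariant_under_spreading smul e"
    and "\<exists>K>0. \<forall>\<alpha> \<in> module.span smul (range e). \<forall>\<beta> \<in> module.span smul (range e).
           1 / K * norm \<alpha> * norm \<beta> \<le> norm (tensor smul e \<alpha> \<beta>) \<and>
           norm (tensor smul e \<alpha> \<beta>) \<le> K * norm \<alpha> * norm \<beta>"
  shows "equivalent_to_c0_basis smul e \<or> (\<exists>p\<ge>1. equivalent_to_lp_basis p smul e)"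
proof -
  obtain C where C: "C > 0" and spread: "\<And>n k a. n \<ge> 1 \<Longrightarrow> strict_mono_on {..<n} k \<Longrightarrow>
        1 / C * norm (\<Sum>i<n. smul (a i) (e i)) \<le> norm (\<Sum>i<n. smul (a i) (e (k i))) \<and>
        norm (\<Sum>i<n. smul (a i) (e (k i))) \<le> C * norm (\<Sum>i<n. smul (a i) (e i))"
    using assms(3) unfolding invariant_under_spreading_def by blast
  obtain K where K: "K > 0" and mult: "\<And>\<alpha> \<beta>. \<alpha> \<in> module.span smul (range e) \<Longrightarrow>
      \<beta> \<in> module.span smul (range e) \<Longrightarrow>
      1 / K * norm \<alpha> * norm \<beta> \<le> norm (tensor smul e \<alpha> \<beta>) \<and>
      norm (tensor smul e \<alpha> \<beta>) \<le> K * norm \<alpha> * norm \<beta>"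
    using assms(4) by blast
  interpret banach_space_over smul by fact
  interpret multiplicative_spreading smul e C K
  proof
    fix n :: nat and k :: "nat \<Rightarrow> nat" and a :: "nat \<Rightarrow> 'k" assume k: "strict_mono_on {..<n} k"
    show "norm (\<Sum>i<n. smul (a i) (e i)) \<le> C * norm (\<Sum>i<n. smul (a i) (e (k i)))"
      "norm (\<Sum>i<n. smul (a i) (e (k i))) \<le> C * norm (\<Sum>i<n. smul (a i) (e i))"
      \<comment> \<open>Spreading is assumed for \<open>n \<ge> 1\<close>; for \<open>n = 0\<close>
        both sums are empty.\<close>
      using spread[OF _ k, of a] C by (cases "n = 0"; simp add: field_simps)+
  next
    fix \<alpha> \<beta> assume "\<alpha> \<in> span (range e)" "\<beta> \<in> span (range e)"
    from mult[OF this] K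
    show "norm \<alpha> * norm \<beta> \<le> K * norm (tensor smul e \<alpha> \<beta>)"
      "norm (tensor smul e \<alpha> \<beta>) \<le> K * norm \<alpha> * norm \<beta>"
      by (simp_all add: field_simps)
  qed (use assms(2) C K in auto)
  show ?thesis by (rule equivalent_to_c0_or_lp)
qed

end
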